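(* Let $\mathcal{H}$ be a separable Hilbert space, let $g,h\in\mathcal{H}$, and let $A$ be a bounded linear operator on $\mathcal{H}$. Suppose that: (i) any $f\in\mathcal{H}$ is recovered from the samples $\{\langle A^n f,g\rangle\}_{n\ge 0}$ in a stable way; (ii) for each positive real number $k$, there exist constants $\lambda_1,\lambda_2\ge 0$ such that $\max\{\lambda_1,\lambda_2\}<\min\{1,2^{k-1}\}$ and, for all $l\in\mathbb{Z}^+$ and all scalars $a_0,\dots,a_l$, $$\Big\|\sum_{n=0}^{l}a_n(A^* )^n(g-h)\Big\|\le\left[\lambda_1\Big\|\sum_{n=0}^{l}a_n(A^* )^n g\Big\|^k+\lambda_2\Big\|\sum_{n=0}^{l}a_n(A^* )^n h\Big\|^k\right]^{1/k}.$$ Then any $f\in\mathcal{H}$ can also be recovered from the samples $\{\langle A^n f,h\rangle\}_{n\ge 0}$ in a stable way.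
   Context: $\mathbb{Z}^+=\{0,1,2,\dots\}$, and $A^*$ denotes the Hilbert-space adjoint of $A$. For a bounded linear operator $C$ on $\mathcal{H}$ and a vector $u\in\mathcal{H}$, "any $f\in\mathcal{H}$ is (can be) recovered from the samples $\{\langle C^n f,u\rangle\}_{n\ge 0}$ in a stable way" means: for every $f\in\mathcal{H}$ the sequence $\{\langle C^n f,u\rangle\}_{n\ge0}$ belongs to $\ell^2(\mathbb{Z}^+)$, and there exists a bounded linear operator $\mathscr{R}:\ell^2(\mathbb{Z}^+)\to\mathcal{H}$ such that $\mathscr{R}(\{\langle C^n f,u\rangle\}_{n\ge0})=f$ for all $f\in\mathcal{H}$. *)

theory Defs
  imports "HOL-Analysis.Analysis"
begin

text \<open>
  The scalar field of a Hilbert space, real or complex. From the two axioms, \<open>x + conjugate x\<close> and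
  \<open>x * conjugate x\<close> are real for every \<open>x\<close>, so each \<open>x\<close> is a root of a real quadratic polynomial;
  hence up to isomorphism the instances below are the only ones.
\<close>

class rc_field = real_normed_field +
  fixes conjugate :: "'a \<Rightarrow> 'a"
  assumes conjugate_add: "conjugate (x + y) = conjugate x + conjugate y"
    and mult_conjugate: "x * conjugate x = (norm x)\<^sup>2 *\<^sub>R 1"

instantiation real :: rc_field
begin
definition conjugate_real :: "real \<Rightarrow> real" where "conjugate_real x = x"
instance by standard (simp_all add: conjugate_real_def power2_eq_square)
end

instantiation complex :: rc_field
begin
definition conjugate_complex :: "complex \<Rightarrow> complex" where "conjugate_complex = cnj"
instance by standard (simp_all only: conjugate_complex_def complex_cnj_add complex_norm_square[symmetric]
    scaleR_conv_of_real mult_1_right)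
end

text \<open>
  Norm, topology and completeness come from \<^class>\<open>banach\<close>. The inner product is linear in its
  first argument.
\<close>

locale hilbert_space = vector_space smul
  for smul :: "'k::rc_field \<Rightarrow> 'a::banach \<Rightarrow> 'a" +
  fixes ip :: "'a \<Rightarrow> 'a \<Rightarrow> 'k"
  assumes smul_of_real: "smul (of_real r) x = r *\<^sub>R x"
    and ip_add_left: "ip (x + y) z = ip x z + ip y z"
    and ip_smul_left: "ip (smul c x) y = c * ip x y"
    and ip_commute: "ip x y = conjugate (ip y x)"
    and ip_self: "ip x x = of_real ((norm x)\<^sup>2)"

lemma hilbert_space_real: "hilbert_space scaleR (inner :: 'a::{real_inner,banach} \<Rightarrow> 'a \<Rightarrow> real)"
  by unfold_locales
    (simp_all add: scaleR_add_right scaleR_add_left inner_add_left inner_add_right inner_commute conjugate_real_def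
      power2_norm_eq_inner)

lemma hilbert_space_complex: "hilbert_space (*) (\<lambda>x y. x * cnj y)"
  by unfold_locales
    (simp_all add: algebra_simps conjugate_complex_def scaleR_conv_of_real complex_norm_square
      del: of_real_power)

definition bounded_operator :: "('k::rc_field \<Rightarrow> 'a::banach \<Rightarrow> 'a) \<Rightarrow> ('a \<Rightarrow> 'a) \<Rightarrow> bool" where
  "bounded_operator smul C \<longleftrightarrow>
    Vector_Spaces.linear smul smul C \<and> (\<exists>K. \<forall>x. norm (C x) \<le> K * norm x)"

text \<open>For a bounded operator on a Hilbert space the description below is satisfied by exactly one
  map: existence is the Riesz representation theorem, uniqueness is \<open>adjoint_eqI\<close>.\<close>

definition adjoint_op :: "('a \<Rightarrow> 'a \<Rightarrow> 'k::rc_field) \<Rightarrow> ('a::banach \<Rightarrow> 'a) \<Rightarrow> 'a \<Rightarrow> 'a" where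
  "adjoint_op ip C = (THE D. \<forall>x y. ip (C x) y = ip x (D y))"

lemma (in hilbert_space) adjoint_eqI:
  assumes "\<And>x y. ip (C x) y = ip x (D y)"
  shows "adjoint_op ip C = D"
  unfolding adjoint_op_def
proof (rule the_equality)
  show "\<forall>x y. ip (C x) y = ip x (D y)" using assms by blast
next
  fix E assume E: "\<forall>x y. ip (C x) y = ip x (E y)"
  have comm: "ip (E y) x = ip (D y) x" for x y
    using E assms ip_commute by metis
  show "E = D"
  proof
    fix y
    have "ip (E y - D y) x + ip (D y) x = ip (E y) x" for x
      using ip_add_left[of "E y - D y" "D y" x] by simp
    then have "ip (E y - D y) (E y - D y) = 0"
      using comm by (metis add_cancel_left_left)
    then show "E y = D y" by (simp add: ip_self)
  qed
qed

definition l2 :: "(nat \<Rightarrow> 'k::rc_field) set" where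
  "l2 = {a. summable (\<lambda>n. (norm (a n))\<^sup>2)}"

definition l2_norm :: "(nat \<Rightarrow> 'k::rc_field) \<Rightarrow> real" where
  "l2_norm a = sqrt (\<Sum>n. (norm (a n))\<^sup>2)"

text \<open>Bounded linear operators from $\ell^2$ to the space; values outside \<^const>\<open>l2\<close> are
  irrelevant.\<close>

definition l2_bounded_operator ::
    "('k::rc_field \<Rightarrow> 'a::banach \<Rightarrow> 'a) \<Rightarrow> ((nat \<Rightarrow> 'k) \<Rightarrow> 'a) \<Rightarrow> bool" where
  "l2_bounded_operator smul R \<longleftrightarrow>
    (\<forall>a\<in>l2. \<forall>b\<in>l2. R (\<lambda>n. a n + b n) = R a + R b) \<and>
    (\<forall>c. \<forall>a\<in>l2. R (\<lambda>n. c * a n) = smul c (R a)) \<and>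
    (\<exists>K. \<forall>a\<in>l2. norm (R a) \<le> K * l2_norm a)"

definition samples :: "('a \<Rightarrow> 'a \<Rightarrow> 'k) \<Rightarrow> ('a \<Rightarrow> 'a) \<Rightarrow> 'a \<Rightarrow> 'a \<Rightarrow> nat \<Rightarrow> 'k" where
  "samples ip C u f = (\<lambda>n. ip ((C ^^ n) f) u)"

definition stably_recoverable ::
    "('k::rc_field \<Rightarrow> 'a::banach \<Rightarrow> 'a) \<Rightarrow> ('a \<Rightarrow> 'a \<Rightarrow> 'k) \<Rightarrow> ('a \<Rightarrow> 'a) \<Rightarrow> 'a \<Rightarrow> bool" where
  "stably_recoverable smul ip C u \<longleftrightarrow>
    (\<forall>f. samples ip C u f \<in> l2) \<and>
    (\<exists>R. l2_bounded_operator smul R \<and> (\<forall>f. R (samples ip C u f) = f))"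

end

theory Submission
  imports Defs
begin

text \<open>
  Take \<open>k = 2\<close> and put \<open>\<phi>\<^sub>n = (A\<^sup>*)\<^sup>n g\<close> and \<open>\<psi>\<^sub>n = (A\<^sup>*)\<^sup>n h\<close>. For a finite combination
  \<open>u\<close> of the \<open>\<phi>\<^sub>n\<close> and the combination \<open>v\<close> of the \<open>\<psi>\<^sub>n\<close> with the same coefficients,
  \<open>\<parallel>u - v\<parallel>\<^sup>2 \<le> \<lambda> (\<parallel>u\<parallel>\<^sup>2 + \<parallel>v\<parallel>\<^sup>2)\<close> with \<open>\<lambda> < 1\<close>, and Stewart's identity with \<open>t = 1 - \<lambda>\<close> turns this into
  \<open>\<parallel>u - t v\<parallel>\<^sup>2 \<le> (1 - t\<^sup>2) \<parallel>u\<parallel>\<^sup>2\<close>. Hence \<open>\<psi>\<close> inherits the Bessel property from \<open>\<phi>\<close>. If \<open>R\<close> recovers from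
  the \<open>\<phi>\<close>-samples and \<open>r\<^sub>n = R e\<^sub>n\<close>, then every \<open>x\<close> is the norm limit of such combinations \<open>u\<close> with
  coefficients \<open>\<langle>x, r\<^sub>n\<rangle>\<close>. Passing to the limit and dualising, \<open>M\<close> := \<open>R\<close> applied to the \<open>\<psi>\<close>-samples
  satisfies \<open>\<parallel>f - t M f\<parallel> \<le> \<surd>(1 - t\<^sup>2) \<parallel>f\<parallel>\<close>, so \<open>M\<close> is invertible and \<open>M\<^sup>-\<^sup>1 R\<close> recovers from the
  \<open>\<psi>\<close>-samples.
\<close>

section \<open>Scalars and inner products\<close>

lemma conjugate_zero [simp]: "conjugate (0::'k::rc_field) = 0"
  using conjugate_add[of "0::'k" 0] by simp

lemma mult_conjugate_of_real: "x * conjugate x = of_real ((norm x)\<^sup>2)" for x :: "'k::rc_field"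
  by (simp only: mult_conjugate of_real_def)

text \<open>Dividing \<open>mult_conjugate\<close> by \<open>x\<close> makes conjugation explicit;
  isometry, multiplicativity and the fixing of real scalars then follow by calculation.\<close>

lemma conjugate_eq: "x \<noteq> 0 \<Longrightarrow> conjugate x = of_real ((norm x)\<^sup>2) / x" for x :: "'k::rc_field"
  using mult_conjugate_of_real[of x] by (metis nonzero_mult_div_cancel_left)

lemma norm_conjugate [simp]: "norm (conjugate x) = norm x" for x :: "'k::rc_field"
proof (cases "x = 0")
  case False
  then show ?thesis
    by (simp add: conjugate_eq norm_divide norm_mult power2_eq_square)
qed simp

lemma conjugate_mult: "conjugate (x * y) = conjugate x * conjugate y" for x y :: "'k::rc_field"
  by (cases "x = 0 \<or> y = 0") (auto simp: conjugate_eq norm_mult power_mult_distrib)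

lemma conjugate_of_real [simp]: "conjugate (of_real r :: 'k::rc_field) = of_real r"
proof (cases "r = 0")
  case False
  then show ?thesis
    by (simp add: conjugate_eq power2_eq_square flip: of_real_mult of_real_divide)
qed simp

context hilbert_space
begin

lemma ip_add_right: "ip x (y + z) = ip x y + ip x z"
  using ip_add_left[of y z x] by (metis ip_commute conjugate_add)

lemma ip_smul_right: "ip x (smul c y) = conjugate c * ip x y"
  using ip_smul_left[of c y x] by (metis ip_commute conjugate_mult)

lemma ip_zero_left [simp]: "ip 0 x = 0"
  using ip_add_left[of 0 0 x] by simp

lemma ip_zero_right [simp]: "ip x 0 = 0"
  using ip_add_right[of x 0 0] by simp

lemma ip_diff_left: "ip (x - y) z = ip x z - ip y z"
  using ip_add_left[of "x - y" y z] by simp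

lemma ip_diff_right: "ip x (y - z) = ip x y - ip x z"
  using ip_add_right[of x "y - z" z] by simp

lemma ip_scaleR_left: "ip (r *\<^sub>R x) y = of_real r * ip x y"
  using ip_smul_left[of "of_real r" x y] by (simp add: smul_of_real)

lemma ip_scaleR_right: "ip x (r *\<^sub>R y) = of_real r * ip x y"
  using ip_smul_right[of x "of_real r" y] by (simp add: smul_of_real)

lemma ip_sum_left: "ip (\<Sum>n\<in>I. x n) y = (\<Sum>n\<in>I. ip (x n) y)"
  by (induction I rule: infinite_finite_induct) (auto simp: ip_add_left)

lemma ip_sum_right: "ip x (\<Sum>n\<in>I. y n) = (\<Sum>n\<in>I. ip x (y n))"
  by (induction I rule: infinite_finite_induct) (auto simp: ip_add_right)

lemma norm_ip_commute: "norm (ip x y) = norm (ip y x)"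
  by (metis ip_commute norm_conjugate)

text \<open>The cross term stays as \<open>ip x y + ip y x\<close>, twice the real part of
  \<open>ip x y\<close>, so that one identity in the scalar field serves real and complex spaces
  alike.\<close>

lemma norm_diff_power2:
  "of_real ((norm (x - r *\<^sub>R y))\<^sup>2)
    = of_real ((norm x)\<^sup>2) - of_real r * (ip x y + ip y x) + of_real (r\<^sup>2 * (norm y)\<^sup>2)"
  unfolding of_real_mult ip_self[symmetric]
  by (simp add: ip_diff_left ip_diff_right ip_scaleR_left ip_scaleR_right algebra_simps power2_eq_square)

text \<open>\<open>norm_diff_power2\<close> at the parameters \<open>t\<close> and \<open>1\<close>
  has the same cross term up to the factor \<open>t\<close>, so the second instance eliminates it
  from the first.\<close>

lemma stewart:
  "(norm (u - t *\<^sub>R v))\<^sup>2 = (1 - t) * (norm u)\<^sup>2 + t * (norm (u - v))\<^sup>2 - t * (1 - t) * (norm v)\<^sup>2"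
  for u v :: 'a
proof -
  have "of_real ((norm (u - t *\<^sub>R v))\<^sup>2)
      = (of_real ((1 - t) * (norm u)\<^sup>2 + t * (norm (u - v))\<^sup>2 - t * (1 - t) * (norm v)\<^sup>2) :: 'k)"
    unfolding norm_diff_power2 of_real_mult of_real_add of_real_diff
      norm_diff_power2[of u 1 v, unfolded scaleR_one]
    by (simp add: algebra_simps power2_eq_square)
  then show ?thesis by (simp only: of_real_eq_iff)
qed

text \<open>The vector is \<open>x\<close> minus its projection onto \<open>y\<close>, multiplied by
  \<open>(norm y)\<^sup>2\<close> to avoid division. Nonnegativity of the left side gives
  Cauchy-Schwarz; the exact value is used for orthogonality in the Riesz theorem.\<close>

lemma norm_scaled_projection:
  "(norm ((norm y)\<^sup>2 *\<^sub>R x - smul (ip x y) y))\<^sup>2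
    = (norm y)\<^sup>2 * ((norm y)\<^sup>2 * (norm x)\<^sup>2 - (norm (ip x y))\<^sup>2)"
proof -
  define s w where "s = (norm y)\<^sup>2" and "w = ip x y"
  have yx: "ip y x = conjugate w" and yy: "ip y y = of_real s" and xx: "ip x x = of_real ((norm x)\<^sup>2)"
    unfolding w_def s_def by (rule ip_commute) (rule ip_self)+
  have "of_real ((norm (s *\<^sub>R x - smul w y))\<^sup>2)
      = of_real s * (of_real s * of_real ((norm x)\<^sup>2) - w * conjugate w)"
    unfolding ip_self[symmetric]
    by (simp add: ip_diff_left ip_diff_right ip_scaleR_left ip_scaleR_right ip_smul_left
        ip_smul_right yx yy xx w_def[symmetric] algebra_simps del: of_real_power)
  also have "\<dots> = of_real (s * (s * (norm x)\<^sup>2 - (norm w)\<^sup>2))"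
    by (simp add: mult_conjugate_of_real)
  finally show ?thesis
    by (simp only: of_real_eq_iff s_def w_def)
qed

lemma Cauchy_Schwarz: "norm (ip x y) \<le> norm x * norm y"
proof (cases "y = 0")
  case False
  then have "0 < (norm y)\<^sup>2" by simp
  with norm_scaled_projection[of y x] have "(norm (ip x y))\<^sup>2 \<le> (norm y)\<^sup>2 * (norm x)\<^sup>2"
    by (metis zero_le_power2 diff_ge_0_iff_ge zero_le_mult_iff not_less)
  then show ?thesis
    by (metis mult.commute norm_ge_zero power2_le_imp_le power_mult_distrib zero_le_mult_iff)
qed simp

lemma tendsto_ip_left:
  assumes "x \<longlonglongrightarrow> x0"
  shows "(\<lambda>n. ip (x n) y) \<longlonglongrightarrow> ip x0 y"
proof (rule Lim_transform_bound[where g = "\<lambda>n. norm (x n - x0) * norm y", THEN LIM_zero_cancel])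
  show "\<forall>\<^sub>F n in sequentially. norm (ip (x n) y - ip x0 y) \<le> norm (norm (x n - x0) * norm y)"
    using Cauchy_Schwarz by (auto simp flip: ip_diff_left)
  show "(\<lambda>n. norm (x n - x0) * norm y) \<longlonglongrightarrow> 0"
    using assms by (intro tendsto_mult_left_zero tendsto_norm_zero LIM_zero)
qed

lemma tendsto_ip_right: "x \<longlonglongrightarrow> x0 \<Longrightarrow> (\<lambda>n. ip y (x n)) \<longlonglongrightarrow> ip y x0"
proof (rule Lim_transform_bound[where g = "\<lambda>n. norm (x n - x0) * norm y", THEN LIM_zero_cancel])
  show "\<forall>\<^sub>F n in sequentially. norm (ip y (x n) - ip y x0) \<le> norm (norm (x n - x0) * norm y)"
    using Cauchy_Schwarz by (auto simp: mult.commute simp flip: ip_diff_right)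
  assume "x \<longlonglongrightarrow> x0"
  then show "(\<lambda>n. norm (x n - x0) * norm y) \<longlonglongrightarrow> 0"
    by (intro tendsto_mult_left_zero tendsto_norm_zero LIM_zero)
qed

lemma ip_eqI:
  assumes "\<And>z. ip x z = ip y z"
  shows "x = y"
proof -
  have "ip (x - y) (x - y) = 0"
    using assms[of "x - y"] by (simp add: ip_diff_left)
  then show ?thesis by (simp add: ip_self)
qed

section \<open>Riesz representation and adjoints\<close>

text \<open>The parallelogram law makes a minimizing sequence Cauchy. Closure under midpoints
  suffices, and the midpoint is written in the form that \<open>stewart\<close> produces for
  \<open>t = 1/2\<close>.\<close>

lemma exists_minimal_norm:
  fixes S :: "'a set"
  assumes S: "S \<noteq> {}" "closed S" and mid: "\<And>x y. x \<in> S \<Longrightarrow> y \<in> S \<Longrightarrow> x - (1/2) *\<^sub>R (x - y) \<in> S"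
  obtains x0 where "x0 \<in> S" "\<And>x. x \<in> S \<Longrightarrow> norm x0 \<le> norm x"
proof -
  define D where "D = Inf ((\<lambda>x. (norm x)\<^sup>2) ` S)"
  have bdd: "bdd_below ((\<lambda>x. (norm x)\<^sup>2) ` S)" by (rule bdd_belowI2[where m = 0]) simp
  have D_le: "D \<le> (norm x)\<^sup>2" if "x \<in> S" for x
    unfolding D_def using that bdd by (rule cINF_lower[rotated])
  have "\<exists>x\<in>S. (norm x)\<^sup>2 < D + e" if "e > 0" for e
    using that S(1) bdd cINF_less_iff[of S "\<lambda>x. (norm x)\<^sup>2" "D + e"] by (simp add: D_def)
  then have "\<forall>n. \<exists>x. x \<in> S \<and> (norm x)\<^sup>2 < D + inverse (real (Suc n))"
    by (metis inverse_positive_iff_positive of_nat_0_less_iff zero_less_Suc)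
  then obtain x where x: "\<And>n. x n \<in> S" "\<And>n. (norm (x n))\<^sup>2 < D + inverse (real (Suc n))"
    by metis
  \<comment> \<open>\<open>stewart\<close> with \<open>v = x m - x n\<close> gives
    \<open>u - v = x n\<close>; the midpoint has squared norm at least \<open>D\<close>, so the
    contributions of \<open>D\<close> cancel.\<close>
  have close: "(norm (x m - x n))\<^sup>2 \<le> 2 * inverse (real (Suc m)) + 2 * inverse (real (Suc n))" for m n
    using D_le[OF mid[OF x(1)[of m] x(1)[of n]]] x(2)[of m] x(2)[of n]
      stewart[of "x m" "1/2" "x m - x n"] by simp
  have "Cauchy x"
  proof (rule metric_CauchyI)
    fix e :: real assume e: "e > 0"
    then have "0 < e\<^sup>2 / 4" by simp
    from reals_Archimedean[OF this] obtain N where N: "inverse (real (Suc N)) < e\<^sup>2 / 4" ..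
    have "dist (x m) (x n) < e" if "m \<ge> N" "n \<ge> N" for m n
    proof -
      have le: "inverse (real (Suc k)) \<le> inverse (real (Suc N))" if "k \<ge> N" for k
        using that by (simp add: le_imp_inverse_le)
      have "(norm (x m - x n))\<^sup>2 < e\<^sup>2"
        using close[of m n] le[OF that(1)] le[OF that(2)] N by linarith
      then show ?thesis
        using e by (simp add: dist_norm power_less_imp_less_base)
    qed
    then show "\<exists>M. \<forall>m\<ge>M. \<forall>n\<ge>M. dist (x m) (x n) < e" by blast
  qed
  then obtain x0 where x0: "x \<longlonglongrightarrow> x0"
    by (auto simp: Cauchy_convergent_iff convergent_def)
  have "(\<lambda>n. D + inverse (real (Suc n))) \<longlonglongrightarrow> D + 0"
    by (intro tendsto_add tendsto_const LIMSEQ_inverse_real_of_nat)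
  then have "(norm x0)\<^sup>2 \<le> D + 0"
    by (rule LIMSEQ_le[OF tendsto_power[OF tendsto_norm[OF x0]]]) (use x(2) less_imp_le in blast)
  then have "norm x0 \<le> norm y" if "y \<in> S" for y
    using D_le[OF that] by (simp add: power2_le_imp_le)
  moreover have "x0 \<in> S"
    using closed_sequentially[OF S(2)] x(1) x0 by blast
  ultimately show ?thesis using that by blast
qed

text \<open>The element \<open>x0\<close> of least norm in the closed hyperplane
  \<open>L x = 1\<close> is orthogonal to the kernel of \<open>L\<close>, and a real multiple of it
  represents \<open>L\<close>.\<close>

lemma Riesz_representation:
  assumes add: "\<And>x y. L (x + y) = L x + L y" and smul: "\<And>c x. L (smul c x) = c * L x"
    and bound: "\<And>x. norm (L x) \<le> K * norm x"
  shows "\<exists>y. \<forall>x. L x = ip x y"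
proof (cases "\<forall>x. L x = 0")
  case True
  then show ?thesis by (intro exI[of _ 0]) simp
next
  case False
  then obtain z where "L z \<noteq> 0" by blast
  define S where "S = {x. L x = 1}"
  have diff: "L (x - y) = L x - L y" for x y using add[of "x - y" y] by simp
  have scaleR: "L (r *\<^sub>R x) = of_real r * L x" for r x
    using smul[of "of_real r" x] by (simp add: smul_of_real)
  have "L (smul (inverse (L z)) z) = 1" using \<open>L z \<noteq> 0\<close> by (simp add: smul)
  then have "S \<noteq> {}" by (auto simp: S_def)
  have "closed S"
  proof -
    have "bounded_linear L"
    proof (rule bounded_linear_intro)
      show "L (x + y) = L x + L y" for x y by (fact add)
      show "L (r *\<^sub>R x) = r *\<^sub>R L x" for r x by (simp add: scaleR scaleR_conv_of_real)
      show "norm (L x) \<le> norm x * K" for x using bound[of x] by (simp add: mult.commute)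
    qed
    then show ?thesis
      unfolding S_def by (intro closed_Collect_eq continuous_intros linear_continuous_on)
  qed
  moreover have "x - (1/2) *\<^sub>R (x - y) \<in> S" if "x \<in> S" "y \<in> S" for x y
    using that by (simp add: S_def diff scaleR)
  ultimately obtain x0 where x0: "x0 \<in> S" "\<And>x. x \<in> S \<Longrightarrow> norm x0 \<le> norm x"
    using \<open>S \<noteq> {}\<close> exists_minimal_norm by metis
  have Lx0: "L x0 = 1" using x0(1) by (simp add: S_def)
  have orth: "ip x0 y = 0" if "L y = 0" for y
  proof (cases "y = 0")
    case False
    define s where "s = (norm y)\<^sup>2"
    have "s > 0" using False by (simp add: s_def)
    \<comment> \<open>Removing the component along \<open>y\<close> stays in \<open>S\<close>
      because \<open>L y = 0\<close>, so minimality of \<open>x0\<close> forces that component to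
      vanish.\<close>
    have "x0 - smul (ip x0 y / of_real s) y \<in> S" by (simp add: S_def diff smul that Lx0)
    then have "norm x0 \<le> norm (x0 - smul (ip x0 y / of_real s) y)" by (rule x0(2))
    then have "s * norm x0 \<le> norm (s *\<^sub>R (x0 - smul (ip x0 y / of_real s) y))"
      using \<open>s > 0\<close> by simp
    also have "s *\<^sub>R (x0 - smul (ip x0 y / of_real s) y) = s *\<^sub>R x0 - smul (ip x0 y) y"
      using \<open>s > 0\<close> unfolding smul_of_real[symmetric]
      by (simp add: scale_right_diff_distrib)
    finally have "(s * norm x0)\<^sup>2 \<le> s * (s * (norm x0)\<^sup>2 - (norm (ip x0 y))\<^sup>2)"
      unfolding s_def norm_scaled_projection[symmetric] by (rule power_mono) simp
    then have "s * (norm (ip x0 y))\<^sup>2 \<le> 0"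
      by (simp add: power2_eq_square algebra_simps)
    then show ?thesis using \<open>s > 0\<close> by (simp add: mult_le_0_iff)
  qed simp
  have "x0 \<noteq> 0" using Lx0 diff[of 0 0] by auto
  have "L x = ip x (smul (1 / of_real ((norm x0)\<^sup>2)) x0)" for x
  proof -
    \<comment> \<open>Every \<open>x\<close> splits into \<open>smul (L x) x0\<close> and a kernel
      element, and the latter is orthogonal to \<open>x0\<close>.\<close>
    have "ip x0 (x - smul (L x) x0) = 0" by (rule orth) (simp add: diff smul Lx0)
    then have "ip (x - smul (L x) x0) x0 = 0" by (metis ip_commute conjugate_zero)
    then have eq: "ip x x0 = L x * of_real ((norm x0)\<^sup>2)"
      by (simp add: ip_diff_left ip_smul_left ip_self)
    have "conjugate (1 / of_real ((norm x0)\<^sup>2) :: 'k) = 1 / of_real ((norm x0)\<^sup>2)"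
      by (metis conjugate_of_real of_real_1 of_real_divide)
    then show ?thesis using \<open>x0 \<noteq> 0\<close> by (simp add: ip_smul_right eq)
  qed
  then show ?thesis by blast
qed

text \<open>Riesz applied to \<open>ip (C x) y\<close> as a functional of \<open>x\<close> supplies
  some adjoint; \<open>adjoint_eqI\<close> identifies it with the described one.\<close>

lemma adjoint_op_works:
  assumes "bounded_operator smul C"
  shows "ip (C x) y = ip x (adjoint_op ip C y)"
proof -
  from assms obtain K where C: "\<And>x y. C (x + y) = C x + C y" "\<And>c x. C (smul c x) = smul c (C x)"
      "\<And>x. norm (C x) \<le> K * norm x"
    unfolding bounded_operator_def Vector_Spaces.linear_iff by blast
  have "\<exists>z. \<forall>x. ip (C x) y = ip x z" for y
  proof (rule Riesz_representation)
    show "norm (ip (C x) y) \<le> (K * norm y) * norm x" for x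
      using order_trans[OF Cauchy_Schwarz mult_right_mono[OF C(3)[of x], of "norm y"]]
      by (simp add: ac_simps)
  qed (simp_all add: C ip_add_left ip_smul_left)
  then obtain D where "\<And>x y. ip (C x) y = ip x (D y)" by metis
  then show ?thesis using adjoint_eqI[of C D] by simp
qed

lemma adjoint_op_power:
  assumes "bounded_operator smul C"
  shows "ip ((C ^^ n) x) y = ip x ((adjoint_op ip C ^^ n) y)"
proof (induction n arbitrary: y)
  case (Suc n)
  then show ?case
    by (simp add: adjoint_op_works[OF assms]) (simp add: funpow_swap1)
qed simp

end

section \<open>Bounded operators on square-summable sequences\<close>

definition restrict_seq :: "nat set \<Rightarrow> (nat \<Rightarrow> 'k::rc_field) \<Rightarrow> nat \<Rightarrow> 'k" where
  "restrict_seq I a = (\<lambda>n. if n \<in> I then a n else 0)"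

definition unit_seq :: "nat \<Rightarrow> nat \<Rightarrow> 'k::rc_field" where
  "unit_seq n = (\<lambda>m. if m = n then 1 else 0)"

lemma norm_restrict_seq_power2:
  "(norm (restrict_seq I a n))\<^sup>2 = (if n \<in> I then (norm (a n))\<^sup>2 else 0)"
  by (simp add: restrict_seq_def)

lemma finite_restrict_seq_in_l2: "finite I \<Longrightarrow> restrict_seq I a \<in> l2"
  by (auto simp: l2_def norm_restrict_seq_power2 intro!: summable_finite[of I])

lemma restrict_seq_in_l2: "a \<in> l2 \<Longrightarrow> restrict_seq I a \<in> l2"
  unfolding l2_def mem_Collect_eq
  by (rule summable_comparison_test'[of _ 0]) (auto simp: norm_restrict_seq_power2)

lemma unit_seq_l2: "unit_seq n \<in> l2"
  using finite_restrict_seq_in_l2[of "{n}" "\<lambda>_. 1"] by (simp add: restrict_seq_def unit_seq_def)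

lemma scaled_unit_seq_l2: "(\<lambda>m. c * unit_seq n m) \<in> l2"
  using finite_restrict_seq_in_l2[of "{n}" "\<lambda>_. c"]
  by (simp add: restrict_seq_def unit_seq_def if_distrib cong: if_cong)

lemma l2_norm_restrict_seq:
  assumes "finite I"
  shows "l2_norm (restrict_seq I a) = sqrt (\<Sum>n\<in>I. (norm (a n))\<^sup>2)"
  using suminf_finite[OF assms, of "\<lambda>n. (norm (restrict_seq I a n))\<^sup>2"]
  by (simp add: l2_norm_def norm_restrict_seq_power2)

text \<open>The squared tail norm is the total minus the partial sum of a convergent series.\<close>

lemma l2_norm_tail_tendsto_0:
  assumes "a \<in> l2"
  shows "(\<lambda>N. l2_norm (restrict_seq {N..} a)) \<longlonglongrightarrow> 0"
proof -
  define f where "f n = (norm (a n))\<^sup>2" for n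
  have f: "summable f" using assms by (simp add: l2_def f_def[abs_def])
  have "(\<Sum>n. (norm (restrict_seq {N..} a n))\<^sup>2) = suminf f - (\<Sum>n<N. f n)" for N
  proof -
    have s: "summable (\<lambda>n. (norm (restrict_seq {N..} a n))\<^sup>2)"
      using restrict_seq_in_l2[OF assms, of "{N..}"] by (simp add: l2_def)
    have "(\<Sum>n. (norm (restrict_seq {N..} a n))\<^sup>2)
        = (\<Sum>n. (norm (restrict_seq {N..} a (n + N)))\<^sup>2) + (\<Sum>n<N. (norm (restrict_seq {N..} a n))\<^sup>2)"
      by (rule suminf_split_initial_segment[OF s])
    also have "\<dots> = (\<Sum>n. f (n + N))" by (simp add: norm_restrict_seq_power2 f_def)
    also have "\<dots> = suminf f - (\<Sum>n<N. f n)" using suminf_split_initial_segment[OF f, of N] by simp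
    finally show ?thesis .
  qed
  moreover have "(\<lambda>N. sqrt (suminf f - (\<Sum>n<N. f n))) \<longlonglongrightarrow> sqrt (suminf f - suminf f)"
    by (intro tendsto_intros summable_LIMSEQ f)
  ultimately show ?thesis by (simp add: l2_norm_def)
qed

context hilbert_space
begin

lemma l2_operator_restrict_seq:
  assumes R: "l2_bounded_operator smul R" and "finite I"
  shows "R (restrict_seq I a) = (\<Sum>n\<in>I. smul (a n) (R (unit_seq n)))"
  using \<open>finite I\<close>
proof induction
  case empty
  \<comment> \<open>That \<open>R\<close> vanishes at the zero sequence comes from homogeneity with
    the scalar 0.\<close>
  have "R (\<lambda>n. 0 * unit_seq 0 n) = smul 0 (R (unit_seq 0))"
    using R unit_seq_l2 unfolding l2_bounded_operator_def by blast
  then show ?case by (simp add: restrict_seq_def)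
next
  case (insert n I)
  have "restrict_seq (insert n I) a = (\<lambda>m. a n * unit_seq n m + restrict_seq I a m)"
    using insert.hyps by (auto simp: restrict_seq_def unit_seq_def)
  then have "R (restrict_seq (insert n I) a) = R (\<lambda>m. a n * unit_seq n m) + R (restrict_seq I a)"
    using R scaled_unit_seq_l2 finite_restrict_seq_in_l2[OF insert.hyps(1)]
    unfolding l2_bounded_operator_def by metis
  also have "R (\<lambda>m. a n * unit_seq n m) = smul (a n) (R (unit_seq n))"
    using R unit_seq_l2 unfolding l2_bounded_operator_def by blast
  finally show ?case using insert by simp
qed

text \<open>The error of a partial sum is, up to sign, \<open>R\<close> applied to a tail of
  \<open>a\<close>, and \<open>R\<close> is bounded.\<close>

lemma l2_operator_series:
  assumes R: "l2_bounded_operator smul R" and a: "a \<in> l2"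
  shows "(\<lambda>n. smul (a n) (R (unit_seq n))) sums R a"
proof -
  obtain K where K: "\<And>b. b \<in> l2 \<Longrightarrow> norm (R b) \<le> K * l2_norm b"
    using R unfolding l2_bounded_operator_def by blast
  have "norm ((\<Sum>n<N. smul (a n) (R (unit_seq n))) - R a) \<le> K * l2_norm (restrict_seq {N..} a)" for N
  proof -
    have "a = (\<lambda>n. restrict_seq {..<N} a n + restrict_seq {N..} a n)"
      by (auto simp: restrict_seq_def)
    then have "R a = R (\<lambda>n. restrict_seq {..<N} a n + restrict_seq {N..} a n)"
      by (rule arg_cong)
    also have "\<dots> = R (restrict_seq {..<N} a) + R (restrict_seq {N..} a)"
      using R restrict_seq_in_l2[OF a] unfolding l2_bounded_operator_def by blast
    finally have "(\<Sum>n<N. smul (a n) (R (unit_seq n))) - R a = - R (restrict_seq {N..} a)"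
      by (simp add: l2_operator_restrict_seq[OF R])
    then show ?thesis
      using K[OF restrict_seq_in_l2[OF a]] by simp
  qed
  then have "(\<lambda>N. (\<Sum>n<N. smul (a n) (R (unit_seq n))) - R a) \<longlonglongrightarrow> 0"
    by (intro Lim_null_comparison[OF _ tendsto_mult_right_zero[OF l2_norm_tail_tendsto_0[OF a]]])
       (auto intro: always_eventually)
  then show ?thesis unfolding sums_def by (rule LIM_zero_cancel)
qed

lemma l2_operator_synthesis_bound:
  assumes R: "l2_bounded_operator smul R"
  obtains B where "B \<ge> 0"
    "\<And>I a. finite I \<Longrightarrow> (norm (\<Sum>n\<in>I. smul (a n) (R (unit_seq n))))\<^sup>2 \<le> B * (\<Sum>n\<in>I. (norm (a n))\<^sup>2)"
proof -
  obtain K where K: "\<And>b. b \<in> l2 \<Longrightarrow> norm (R b) \<le> K * l2_norm b"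
    using R unfolding l2_bounded_operator_def by blast
  have "(norm (\<Sum>n\<in>I. smul (a n) (R (unit_seq n))))\<^sup>2 \<le> K\<^sup>2 * (\<Sum>n\<in>I. (norm (a n))\<^sup>2)"
    if "finite I" for I and a :: "nat \<Rightarrow> 'k"
  proof -
    have "norm (\<Sum>n\<in>I. smul (a n) (R (unit_seq n))) \<le> K * sqrt (\<Sum>n\<in>I. (norm (a n))\<^sup>2)"
      using K[OF finite_restrict_seq_in_l2[OF that, of a]]
      by (simp add: l2_operator_restrict_seq[OF R that] l2_norm_restrict_seq[OF that])
    then have "(norm (\<Sum>n\<in>I. smul (a n) (R (unit_seq n))))\<^sup>2 \<le> (K * sqrt (\<Sum>n\<in>I. (norm (a n))\<^sup>2))\<^sup>2"
      by (rule power_mono) simp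
    then show ?thesis by (simp add: power_mult_distrib sum_nonneg)
  qed
  then show ?thesis using that[of "K\<^sup>2"] by simp
qed

section \<open>Bessel sequences\<close>

text \<open>Synthesizing the coefficients of \<open>x\<close> itself gives \<open>u\<close> with
  \<open>ip x u = S\<close>; Cauchy-Schwarz and the hypothesis bound \<open>S\<^sup>2\<close> by a
  multiple of \<open>S\<close>, and one factor \<open>S\<close> cancels.\<close>

lemma analysis_bound_of_synthesis_bound:
  assumes synth: "\<And>a. (norm (\<Sum>n\<in>I. smul (a n) (\<phi> n)))\<^sup>2 \<le> B * (\<Sum>n\<in>I. (norm (a n))\<^sup>2)"
    and "B \<ge> 0"
  shows "(\<Sum>n\<in>I. (norm (ip x (\<phi> n)))\<^sup>2) \<le> B * (norm x)\<^sup>2"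
proof -
  define S where "S = (\<Sum>n\<in>I. (norm (ip x (\<phi> n)))\<^sup>2)"
  define u where "u = (\<Sum>n\<in>I. smul (ip x (\<phi> n)) (\<phi> n))"
  have "S \<ge> 0" by (simp add: S_def sum_nonneg)
  have "ip x u = of_real S"
    by (simp add: u_def S_def ip_sum_right ip_smul_right mult.commute[of "conjugate _"]
        mult_conjugate_of_real del: of_real_power)
  then have "S \<le> norm x * norm u"
    using Cauchy_Schwarz[of x u] \<open>S \<ge> 0\<close> by simp
  then have "S\<^sup>2 \<le> (norm x)\<^sup>2 * (norm u)\<^sup>2"
    using \<open>S \<ge> 0\<close> by (metis power_mono power_mult_distrib)
  also have "\<dots> \<le> (norm x)\<^sup>2 * (B * S)"
    using synth[of "\<lambda>n. ip x (\<phi> n)"] by (intro mult_left_mono) (simp_all add: u_def S_def)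
  finally have "S * S \<le> (B * (norm x)\<^sup>2) * S" by (simp add: power2_eq_square ac_simps)
  then have "S \<le> B * (norm x)\<^sup>2"
    using \<open>S \<ge> 0\<close> \<open>B \<ge> 0\<close> by (cases "S = 0") (simp_all add: mult_le_cancel_right)
  then show ?thesis by (simp add: S_def)
qed

text \<open>The dual argument: expand \<open>ip u u\<close> in the coefficients, apply
  Cauchy-Schwarz for finite sums, and cancel \<open>(norm u)\<^sup>2\<close>.\<close>

lemma synthesis_bound_of_analysis_bound:
  assumes ana: "\<And>x. (\<Sum>n\<in>I. (norm (ip x (\<phi> n)))\<^sup>2) \<le> B * (norm x)\<^sup>2" and "B \<ge> 0"
  shows "(norm (\<Sum>n\<in>I. smul (a n) (\<phi> n)))\<^sup>2 \<le> B * (\<Sum>n\<in>I. (norm (a n))\<^sup>2)"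
proof -
  define u where "u = (\<Sum>n\<in>I. smul (a n) (\<phi> n))"
  define S where "S = (\<Sum>n\<in>I. (norm (a n))\<^sup>2)"
  have "S \<ge> 0" by (simp add: S_def sum_nonneg)
  have "ip u u = (\<Sum>n\<in>I. a n * ip (\<phi> n) u)"
    by (subst u_def) (simp add: ip_sum_left ip_smul_left)
  then have "(norm u)\<^sup>2 = norm (\<Sum>n\<in>I. a n * ip (\<phi> n) u)"
    by (metis abs_of_nonneg ip_self norm_of_real zero_le_power2)
  also have "\<dots> \<le> (\<Sum>n\<in>I. norm (a n) * norm (ip u (\<phi> n)))"
    by (rule sum_norm_le) (simp add: norm_mult norm_ip_commute[of u])
  finally have "((norm u)\<^sup>2)\<^sup>2 \<le> (\<Sum>n\<in>I. norm (a n) * norm (ip u (\<phi> n)))\<^sup>2"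
    by (rule power_mono) simp
  also have "\<dots> \<le> S * (\<Sum>n\<in>I. (norm (ip u (\<phi> n)))\<^sup>2)"
    unfolding S_def by (rule Cauchy_Schwarz_ineq_sum)
  also have "\<dots> \<le> S * (B * (norm u)\<^sup>2)"
    using ana \<open>S \<ge> 0\<close> by (intro mult_left_mono)
  finally have le: "(norm u)\<^sup>2 * (norm u)\<^sup>2 \<le> (B * S) * (norm u)\<^sup>2"
    by (simp add: power2_eq_square ac_simps)
  have "(norm u)\<^sup>2 \<le> B * S"
  proof (cases "u = 0")
    case False
    then show ?thesis by (intro mult_right_le_imp_le[OF le]) simp
  qed (simp add: \<open>S \<ge> 0\<close> \<open>B \<ge> 0\<close>)
  then show ?thesis by (simp add: u_def S_def)
qed

lemma continuous_on_ip_left: "continuous_on UNIV (\<lambda>x. ip x y)"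
  unfolding continuous_on_sequentially by (auto simp: comp_def intro: tendsto_ip_left)

text \<open>An instance of the uniform boundedness principle, via the Baire category theorem.\<close>

lemma Bessel_bound_exists:
  assumes l2: "\<And>x. (\<lambda>n. ip x (\<phi> n)) \<in> l2"
  obtains B where "B \<ge> 0" "\<And>x I. finite I \<Longrightarrow> (\<Sum>n\<in>I. (norm (ip x (\<phi> n)))\<^sup>2) \<le> B * (norm x)\<^sup>2"
proof -
  define F where
    "F K = {x. \<forall>I\<in>Collect finite. (\<Sum>n\<in>I. (norm (ip x (\<phi> n)))\<^sup>2) \<le> real K}" for K :: nat
  have "closed (F K)" for K
    unfolding F_def Ball_def
    by (intro closed_Collect_all closed_Collect_imp closed_Collect_le open_Collect_const
        continuous_intros continuous_on_ip_left)
  moreover have "(\<Union>K. F K) = UNIV"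
  proof -
    have "\<exists>K. x \<in> F K" for x
    proof -
      obtain K where K: "(\<Sum>n. (norm (ip x (\<phi> n)))\<^sup>2) \<le> real K" using real_arch_simple by blast
      have "(\<Sum>n\<in>I. (norm (ip x (\<phi> n)))\<^sup>2) \<le> real K" if "finite I" for I
        using l2[of x] that by (intro order_trans[OF sum_le_suminf K]) (auto simp: l2_def)
      then show ?thesis by (auto simp: F_def)
    qed
    then show ?thesis by auto
  qed
  ultimately have "\<exists>K. interior (F K) \<noteq> {}"
    using Baire_category_alt[of "euclidean :: 'a topology" "range F"]
    by (auto simp: completely_metrizable_space_euclidean)
  then obtain K x0 where "x0 \<in> interior (F K)" by blast
  then obtain e where e: "e > 0" "ball x0 e \<subseteq> F K" by (meson mem_interior)
  \<comment> \<open>A multiple of \<open>x\<close> of length \<open>e / 2\<close> is a difference of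
    two points of \<open>F K\<close>. The inequality (p + q)^2 <= 2 p^2 + 2 q^2 gives
    \<open>4 * real K\<close>, and rescaling to \<open>x\<close> gives the factor
    \<open>(2 / e)\<^sup>2\<close>.\<close>
  have "(\<Sum>n\<in>I. (norm (ip x (\<phi> n)))\<^sup>2) \<le> (4 * real K * (2 / e)\<^sup>2) * (norm x)\<^sup>2"
    if I: "finite I" for x I
  proof (cases "x = 0")
    case False
    define c where "c = e / (2 * norm x)"
    have "c > 0" using e(1) False by (simp add: c_def)
    have "x0 + c *\<^sub>R x \<in> ball x0 e" using e(1) False by (simp add: dist_norm c_def)
    then have "x0 + c *\<^sub>R x \<in> F K" "x0 \<in> F K" using e by auto
    then have K: "(\<Sum>n\<in>I. (norm (ip (x0 + c *\<^sub>R x) (\<phi> n)))\<^sup>2) \<le> K" "(\<Sum>n\<in>I. (norm (ip x0 (\<phi> n)))\<^sup>2) \<le> K"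
      using I by (auto simp: F_def)
    have "c\<^sup>2 * (norm (ip x (\<phi> n)))\<^sup>2
        \<le> 2 * (norm (ip (x0 + c *\<^sub>R x) (\<phi> n)))\<^sup>2 + 2 * (norm (ip x0 (\<phi> n)))\<^sup>2" for n
    proof -
      define p q where "p = ip (x0 + c *\<^sub>R x) (\<phi> n)" and "q = ip x0 (\<phi> n)"
      have "of_real c * ip x (\<phi> n) = p - q" by (simp add: p_def q_def ip_add_left ip_scaleR_left)
      then have "c * norm (ip x (\<phi> n)) = norm (p - q)"
        using \<open>c > 0\<close> by (metis abs_of_pos norm_mult norm_of_real)
      also have "\<dots> \<le> norm p + norm q" by (rule norm_triangle_ineq4)
      finally have "(c * norm (ip x (\<phi> n)))\<^sup>2 \<le> (norm p + norm q)\<^sup>2"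
        using \<open>c > 0\<close> by (intro power_mono) auto
      also have "\<dots> \<le> 2 * (norm p)\<^sup>2 + 2 * (norm q)\<^sup>2"
        using zero_le_power2[of "norm p - norm q"] by (simp add: power2_sum power2_diff)
      finally show ?thesis by (simp add: p_def q_def power_mult_distrib)
    qed
    then have "(\<Sum>n\<in>I. c\<^sup>2 * (norm (ip x (\<phi> n)))\<^sup>2) \<le>
        (\<Sum>n\<in>I. 2 * (norm (ip (x0 + c *\<^sub>R x) (\<phi> n)))\<^sup>2 + 2 * (norm (ip x0 (\<phi> n)))\<^sup>2)"
      by (intro sum_mono)
    then have "c\<^sup>2 * (\<Sum>n\<in>I. (norm (ip x (\<phi> n)))\<^sup>2) \<le> 4 * real K"
      using K by (simp add: sum.distrib flip: sum_distrib_left)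
    then have "(\<Sum>n\<in>I. (norm (ip x (\<phi> n)))\<^sup>2) \<le> 4 * real K / c\<^sup>2"
      using \<open>c > 0\<close> by (simp add: field_simps)
    also have "\<dots> = (4 * real K * (2 / e)\<^sup>2) * (norm x)\<^sup>2"
      using e(1) False by (simp add: c_def field_simps power2_eq_square)
    finally show ?thesis .
  qed simp
  then show ?thesis using that[of "4 * real K * (2 / e)\<^sup>2"] by simp
qed

lemma Bessel_series_summable:
  assumes "B \<ge> 0" and B: "\<And>x I. finite I \<Longrightarrow> (\<Sum>n\<in>I. (norm (ip x (\<phi> n)))\<^sup>2) \<le> B * (norm x)\<^sup>2"
    and a: "a \<in> l2"
  shows "summable (\<lambda>n. smul (a n) (\<phi> n))"
  unfolding summable_Cauchy
proof (intro allI impI)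
  fix e :: real assume e: "e > 0"
  \<comment> \<open>\<open>B + 1\<close> replaces \<open>B\<close> so that the divisor is positive
    even for \<open>B = 0\<close>.\<close>
  then have "e\<^sup>2 / (B + 1) > 0" using \<open>B \<ge> 0\<close> by simp
  then obtain N where N: "\<And>m n. m \<ge> N \<Longrightarrow> norm (\<Sum>k=m..<n. (norm (a k))\<^sup>2) < e\<^sup>2 / (B + 1)"
    using a unfolding l2_def mem_Collect_eq summable_Cauchy by blast
  have "norm (\<Sum>k=m..<n. smul (a k) (\<phi> k)) < e" if "m \<ge> N" for m n
  proof -
    have "(norm (\<Sum>k=m..<n. smul (a k) (\<phi> k)))\<^sup>2 \<le> B * (\<Sum>k=m..<n. (norm (a k))\<^sup>2)"
      by (rule synthesis_bound_of_analysis_bound) (simp_all add: B \<open>B \<ge> 0\<close>)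
    also have "\<dots> \<le> (B + 1) * (\<Sum>k=m..<n. (norm (a k))\<^sup>2)"
      by (simp add: mult_right_mono sum_nonneg)
    also have "\<dots> < e\<^sup>2"
      using N[OF that, of n] \<open>B \<ge> 0\<close> by (simp add: sum_nonneg field_simps)
    finally show ?thesis using e by (simp add: power_less_imp_less_base)
  qed
  then show "\<exists>N. \<forall>m\<ge>N. \<forall>n. norm (\<Sum>k=m..<n. smul (a k) (\<phi> k)) < e" by blast
qed

lemma l2I_bounded_sums:
  assumes "\<And>N. (\<Sum>n<N. (norm (a n))\<^sup>2) \<le> C"
  shows "a \<in> l2"
  unfolding l2_def mem_Collect_eq
  by (rule summableI_nonneg_bounded[OF _ assms]) simp

section \<open>Perturbation of stable recovery\<close>

text \<open>Solving \<open>M x = y\<close> is finding the fixed point of a map that contracts by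
  \<open>q\<close>. Uniqueness of the solution makes the inverse \<open>W\<close> linear; splitting
  \<open>W y\<close> into \<open>W y - t *\<^sub>R y\<close> and \<open>t *\<^sub>R y\<close> bounds
  it.\<close>

lemma bounded_inverse_exists:
  assumes add: "\<And>x y. M (x + y) = M x + M y" and smul: "\<And>c x. M (smul c x) = smul c (M x)"
    and near_id: "\<And>x. norm (x - t *\<^sub>R M x) \<le> q * norm x" and q: "0 \<le> q" "q < 1" and t: "t > 0"
  obtains W where "\<And>x y. W (x + y) = W x + W y" "\<And>c x. W (smul c x) = smul c (W x)"
    "\<And>x. norm (W x) \<le> t / (1 - q) * norm x" "\<And>x. W (M x) = x"
proof -
  have diff: "M (x - y) = M x - M y" for x y using add[of "x - y" y] by simp
  have "\<exists>!x. M x = y" for y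
  proof -
    have "\<exists>!x. x - t *\<^sub>R M x + t *\<^sub>R y = x"
    proof (rule banach_fix_type[OF q], intro allI)
      show "dist (x - t *\<^sub>R M x + t *\<^sub>R y) (z - t *\<^sub>R M z + t *\<^sub>R y) \<le> q * dist x z" for x z
        using near_id[of "x - z"] by (simp add: dist_norm diff algebra_simps)
    qed
    moreover have "x - t *\<^sub>R M x + t *\<^sub>R y = x \<longleftrightarrow> M x = y" for x
      using t by (auto simp: algebra_simps)
    ultimately show ?thesis by simp
  qed
  then obtain W where W: "\<And>y. M (W y) = y" and unique: "\<And>x y. M x = y \<Longrightarrow> W y = x"
    by metis
  have "norm (W y) \<le> t / (1 - q) * norm y" for y
  proof -
    have "norm (W y) \<le> norm (W y - t *\<^sub>R M (W y)) + norm (t *\<^sub>R M (W y))"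
      by (metis diff_add_cancel norm_triangle_ineq)
    then have "(1 - q) * norm (W y) \<le> t * norm y"
      using near_id[of "W y"] t by (simp add: W algebra_simps)
    then show ?thesis using q by (simp add: field_simps)
  qed
  then show ?thesis
    using that[of W] by (simp add: unique add smul W)
qed

text \<open>The two finite operators are adjoint to each other. With \<open>r n\<close> the image of
  the n-th unit sequence under \<open>R\<close>, the right-hand sum is a partial sum of
  \<open>R\<close> applied to the samples of \<open>f\<close>.\<close>

lemma ip_synthesis_swap:
  "ip (\<Sum>n\<in>I. smul (ip x (r n)) (\<eta> n)) f = ip x (\<Sum>n\<in>I. smul (ip f (\<eta> n)) (r n))"
  unfolding ip_sum_left ip_sum_right ip_smul_left ip_smul_right
  by (rule sum.cong) (simp_all add: mult.commute flip: ip_commute)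

lemma norm_le_of_ip_le:
  assumes "\<And>x. norm (ip x z) \<le> C * norm x" and "C \<ge> 0"
  shows "norm z \<le> C"
proof (cases "z = 0")
  case False
  have "norm z * norm z \<le> C * norm z"
    using assms(1)[of z] by (simp add: ip_self norm_power power2_eq_square norm_mult)
  then show ?thesis using False by simp
qed (simp add: assms)

text \<open>The argument for two arbitrary sequences; \<open>close\<close> is the case
  \<open>k = 2\<close> with both constants replaced by their maximum.\<close>

theorem recovery_perturbation:
  assumes l2: "\<And>f. (\<lambda>n. ip f (\<phi> n)) \<in> l2"
    and R: "l2_bounded_operator smul R" and rec: "\<And>f. R (\<lambda>n. ip f (\<phi> n)) = f"
    and lam: "0 \<le> lam" "lam < 1"
    and close: "\<And>N a. (norm (\<Sum>n<N. smul (a n) (\<phi> n - \<psi> n)))\<^sup>2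
      \<le> lam * ((norm (\<Sum>n<N. smul (a n) (\<phi> n)))\<^sup>2 + (norm (\<Sum>n<N. smul (a n) (\<psi> n)))\<^sup>2)"
  shows "(\<forall>f. (\<lambda>n. ip f (\<psi> n)) \<in> l2)
    \<and> (\<exists>R'. l2_bounded_operator smul R' \<and> (\<forall>f. R' (\<lambda>n. ip f (\<psi> n)) = f))"
proof -
  \<comment> \<open>With this \<open>t\<close> the \<open>v\<close> terms cancel once
    \<open>close\<close> is inserted into \<open>stewart\<close>, and the coefficient of
    \<open>(norm u)\<^sup>2\<close> becomes
    \<open>(1 - t) + t * lam = 1 - t\<^sup>2\<close>.\<close>
  define t q r where "t = 1 - lam" and "q = sqrt (1 - t\<^sup>2)" and "r n = R (unit_seq n)" for n
  have t: "0 < t" "t \<le> 1" using lam by (simp_all add: t_def)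
  have q: "0 \<le> q" "q < 1" using t by (simp_all add: q_def abs_square_le_1)
  have contr: "norm ((\<Sum>n<N. smul (a n) (\<phi> n)) - t *\<^sub>R (\<Sum>n<N. smul (a n) (\<psi> n)))
      \<le> q * norm (\<Sum>n<N. smul (a n) (\<phi> n))" for N a
  proof -
    define u v where "u = (\<Sum>n<N. smul (a n) (\<phi> n))" and "v = (\<Sum>n<N. smul (a n) (\<psi> n))"
    have "(norm (u - v))\<^sup>2 \<le> lam * ((norm u)\<^sup>2 + (norm v)\<^sup>2)"
      using close[where N = N and a = a] by (simp add: u_def v_def scale_right_diff_distrib sum_subtractf)
    then have "t * (norm (u - v))\<^sup>2 \<le> t * (lam * ((norm u)\<^sup>2 + (norm v)\<^sup>2))"
      using t by (intro mult_left_mono) auto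
    then have "(norm (u - t *\<^sub>R v))\<^sup>2 \<le> (1 - t\<^sup>2) * (norm u)\<^sup>2"
      unfolding stewart by (simp add: t_def algebra_simps power2_eq_square)
    then have "norm (u - t *\<^sub>R v) \<le> sqrt ((1 - t\<^sup>2) * (norm u)\<^sup>2)"
      by (rule real_le_rsqrt)
    then show ?thesis
      by (simp add: u_def v_def q_def real_sqrt_mult)
  qed
  obtain B where B: "B \<ge> 0" "\<And>x I. finite I \<Longrightarrow> (\<Sum>n\<in>I. (norm (ip x (\<phi> n)))\<^sup>2) \<le> B * (norm x)\<^sup>2"
    using Bessel_bound_exists[OF l2] by blast
  have psi_l2: "(\<lambda>n. ip f (\<psi> n)) \<in> l2" for f
  proof (rule l2I_bounded_sums)
    fix N
    \<comment> \<open>As \<open>q < 1\<close>, \<open>contr\<close> gives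
      \<open>norm v \<le> (2 / t) * norm u\<close>, so the Bessel bound of \<phi> grows by the
      square of \<open>2 / t\<close>.\<close>
    show "(\<Sum>n<N. (norm (ip f (\<psi> n)))\<^sup>2) \<le> ((2 / t)\<^sup>2 * B) * (norm f)\<^sup>2"
    proof (rule analysis_bound_of_synthesis_bound)
      fix a
      define u v where "u = (\<Sum>n<N. smul (a n) (\<phi> n))" and "v = (\<Sum>n<N. smul (a n) (\<psi> n))"
      have "norm (t *\<^sub>R v) \<le> norm u + norm (u - t *\<^sub>R v)"
        using norm_triangle_ineq4[of u "u - t *\<^sub>R v"] by simp
      also have "\<dots> \<le> norm u + q * norm u"
        using contr[where N = N and a = a] by (simp add: u_def v_def)
      also have "\<dots> \<le> 2 * norm u" using q by (simp add: mult_left_le_one_le)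
      finally have "norm v \<le> (2 / t) * norm u" using t by (simp add: field_simps)
      then have "(norm v)\<^sup>2 \<le> ((2 / t) * norm u)\<^sup>2" by (rule power_mono) simp
      also have "\<dots> = (2 / t)\<^sup>2 * (norm u)\<^sup>2" by (rule power_mult_distrib)
      also have "\<dots> \<le> (2 / t)\<^sup>2 * (B * (\<Sum>n<N. (norm (a n))\<^sup>2))"
        unfolding u_def
        by (intro mult_left_mono synthesis_bound_of_analysis_bound) (simp_all add: B)
      finally show "(norm (\<Sum>n<N. smul (a n) (\<psi> n)))\<^sup>2 \<le> ((2 / t)\<^sup>2 * B) * (\<Sum>n<N. (norm (a n))\<^sup>2)"
        by (simp add: v_def mult.assoc)
    qed (simp add: B)
  qed
  have dual_l2: "(\<lambda>n. ip x (r n)) \<in> l2" for x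
  proof -
    obtain C where "C \<ge> 0"
      "\<And>I a. finite I \<Longrightarrow> (norm (\<Sum>n\<in>I. smul (a n) (r n)))\<^sup>2 \<le> C * (\<Sum>n\<in>I. (norm (a n))\<^sup>2)"
      using l2_operator_synthesis_bound[OF R] unfolding r_def by blast
    then show ?thesis
      by (intro l2I_bounded_sums[where C = "C * (norm x)\<^sup>2"] analysis_bound_of_synthesis_bound) auto
  qed
  have swap_tendsto: "(\<lambda>N. ip (\<Sum>n<N. smul (ip x (r n)) (\<eta> n)) f) \<longlonglongrightarrow> ip x (R (\<lambda>n. ip f (\<eta> n)))"
    if "(\<lambda>n. ip f (\<eta> n)) \<in> l2" for x f \<eta>
    unfolding ip_synthesis_swap
    by (rule tendsto_ip_right) (use l2_operator_series[OF R that] in \<open>simp add: sums_def r_def\<close>)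
  \<comment> \<open>The Bessel property of \<phi> and \<open>dual_l2\<close> give norm convergence;
    pairing with \<open>f\<close> and using \<open>rec\<close> identifies the limit. Norm
    convergence matters because \<open>near_id\<close> needs the norms of the partial sums to tend
    to \<open>norm x\<close>.\<close>
  have expansion: "(\<lambda>N. \<Sum>n<N. smul (ip x (r n)) (\<phi> n)) \<longlonglongrightarrow> x" for x
  proof -
    obtain y where y: "(\<lambda>N. \<Sum>n<N. smul (ip x (r n)) (\<phi> n)) \<longlonglongrightarrow> y"
      using Bessel_series_summable[OF B dual_l2] by (auto simp: summable_def sums_def)
    have "ip y f = ip x f" for f
      using LIMSEQ_unique[OF tendsto_ip_left[OF y] swap_tendsto[OF l2]] by (simp add: rec)
    then have "y = x" by (rule ip_eqI)
    with y show ?thesis by simp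
  qed
  define M where "M f = R (\<lambda>n. ip f (\<psi> n))" for f
  \<comment> \<open>Tested against \<open>x\<close>: \<open>contr\<close> bounds each partial sum
    and survives the limit. The sums \<open>v N\<close> enter only through their pairing with
    \<open>f\<close>, whose limit is given by \<open>swap_tendsto\<close>.\<close>
  have near_id: "norm (f - t *\<^sub>R M f) \<le> q * norm f" for f
  proof (rule norm_le_of_ip_le)
    fix x
    define u v where "u N = (\<Sum>n<N. smul (ip x (r n)) (\<phi> n))"
      and "v N = (\<Sum>n<N. smul (ip x (r n)) (\<psi> n))" for N
    have "(\<lambda>N. ip (u N) f - of_real t * ip (v N) f) \<longlonglongrightarrow> ip x f - of_real t * ip x (M f)"
      unfolding u_def v_def M_def
      by (intro tendsto_intros swap_tendsto psi_l2 tendsto_ip_left expansion)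
    then have "(\<lambda>N. norm (ip (u N - t *\<^sub>R v N) f)) \<longlonglongrightarrow> norm (ip x (f - t *\<^sub>R M f))"
      by (intro tendsto_norm) (simp add: ip_diff_left ip_diff_right ip_scaleR_left ip_scaleR_right)
    moreover have "(\<lambda>N. q * norm (u N) * norm f) \<longlonglongrightarrow> q * norm x * norm f"
      unfolding u_def by (intro tendsto_intros expansion)
    moreover have "norm (ip (u N - t *\<^sub>R v N) f) \<le> q * norm (u N) * norm f" for N
      by (rule order_trans[OF Cauchy_Schwarz mult_right_mono]) (simp_all add: u_def v_def contr)
    ultimately have "norm (ip x (f - t *\<^sub>R M f)) \<le> q * norm x * norm f"
      by (intro LIMSEQ_le) auto
    then show "norm (ip x (f - t *\<^sub>R M f)) \<le> (q * norm f) * norm x" by (simp add: ac_simps)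
  qed (simp add: q)
  have R_add: "R (\<lambda>n. a n + b n) = R a + R b" if "a \<in> l2" "b \<in> l2" for a b
    using R that unfolding l2_bounded_operator_def by blast
  have R_smul: "R (\<lambda>n. c * a n) = smul c (R a)" if "a \<in> l2" for c a
    using R that unfolding l2_bounded_operator_def by blast
  have M_add: "M (f + g) = M f + M g" for f g
    unfolding M_def ip_add_left by (rule R_add[OF psi_l2 psi_l2])
  have M_smul: "M (smul c f) = smul c (M f)" for c f
    unfolding M_def ip_smul_left by (rule R_smul[OF psi_l2])
  obtain W where W: "\<And>x y. W (x + y) = W x + W y" "\<And>c x. W (smul c x) = smul c (W x)"
      "\<And>x. norm (W x) \<le> t / (1 - q) * norm x" "\<And>x. W (M x) = x"
    using bounded_inverse_exists[of M, OF M_add M_smul near_id q t(1)] by metis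
  have "l2_bounded_operator smul (\<lambda>a. W (R a))"
  proof -
    obtain K where K: "\<And>b. b \<in> l2 \<Longrightarrow> norm (R b) \<le> K * l2_norm b"
      using R unfolding l2_bounded_operator_def by blast
    have "norm (W (R b)) \<le> (t / (1 - q) * K) * l2_norm b" if "b \<in> l2" for b
    proof -
      have "norm (W (R b)) \<le> t / (1 - q) * norm (R b)" by (rule W)
      also have "\<dots> \<le> t / (1 - q) * (K * l2_norm b)"
        using K[OF that] t q by (intro mult_left_mono) auto
      finally show ?thesis by (simp add: mult.assoc)
    qed
    then show ?thesis
      unfolding l2_bounded_operator_def
      by (intro conjI exI[of _ "t / (1 - q) * K"]) (simp_all add: R_add R_smul W(1,2))
  qed
  moreover have "W (R (\<lambda>n. ip f (\<psi> n))) = f" for f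
    using W(4)[of f] by (simp add: M_def)
  ultimately show ?thesis using psi_l2 by blast
qed

end

section \<open>Application to the orbits of the adjoint\<close>

theorem theorem4p1:
  fixes smul :: "'k::rc_field \<Rightarrow> 'a::banach \<Rightarrow> 'a"
    and ip :: "'a \<Rightarrow> 'a \<Rightarrow> 'k"
    and A :: "'a \<Rightarrow> 'a"
    and g h :: 'a
  assumes hilbert: "hilbert_space smul ip"
    and separable: "separable_space (euclidean :: 'a topology)"
    and bounded: "bounded_operator smul A"
    and recover_g: "stably_recoverable smul ip A g"
    and perturb: "\<And>k::real. k > 0 \<Longrightarrow>
      \<exists>lam1 lam2 :: real. lam1 \<ge> 0 \<and> lam2 \<ge> 0 \<and> max lam1 lam2 < min 1 (2 powr (k - 1)) \<and>
        (\<forall>(l::nat) (a :: nat \<Rightarrow> 'k).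
          norm (\<Sum>n=0..l. smul (a n) ((adjoint_op ip A ^^ n) (g - h)))
            \<le> (lam1 * norm (\<Sum>n=0..l. smul (a n) ((adjoint_op ip A ^^ n) g)) powr k
               + lam2 * norm (\<Sum>n=0..l. smul (a n) ((adjoint_op ip A ^^ n) h)) powr k)
              powr (1 / k))"
  shows "stably_recoverable smul ip A h"
proof -
  interpret hilbert_space smul ip by (fact hilbert)
  define \<phi> where "\<phi> n u = (adjoint_op ip A ^^ n) u" for n u
  have samples: "samples ip A u f = (\<lambda>n. ip f (\<phi> n u))" for u f
    by (simp add: samples_def adjoint_op_power[OF bounded] \<phi>_def)
  \<comment> \<open>Moving the adjoint power across the inner product leaves \<open>g - h\<close> in
    the second argument, where \<open>ip\<close> is additive; \<open>ip_commute\<close> first brings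
    the sides into that position.\<close>
  have diff: "\<phi> n (g - h) = \<phi> n g - \<phi> n h" for n
    by (rule ip_eqI, subst (1 2) ip_commute, rule arg_cong[where f = conjugate])
      (simp add: ip_diff_right \<phi>_def flip: adjoint_op_power[OF bounded])
  obtain R where R: "l2_bounded_operator smul R" "\<And>f. R (\<lambda>n. ip f (\<phi> n g)) = f"
    and l2: "\<And>f. (\<lambda>n. ip f (\<phi> n g)) \<in> l2"
    using recover_g unfolding stably_recoverable_def samples by blast
  \<comment> \<open>For \<open>k = 2\<close> the upper bound \<open>min 1 (2 powr (k - 1))\<close>
    equals 1.\<close>
  obtain lam1 lam2 :: real where lam: "lam1 \<ge> 0" "lam2 \<ge> 0" "max lam1 lam2 < 1"
    and close: "\<And>l a. norm (\<Sum>n=0..l. smul (a n) (\<phi> n g - \<phi> n h))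
      \<le> (lam1 * norm (\<Sum>n=0..l. smul (a n) (\<phi> n g)) powr 2
         + lam2 * norm (\<Sum>n=0..l. smul (a n) (\<phi> n h)) powr 2) powr (1 / 2)"
    using perturb[of 2] by (auto simp flip: \<phi>_def simp: diff)
  define lam where "lam = max lam1 lam2"
  have "(norm (\<Sum>n<N. smul (a n) (\<phi> n g - \<phi> n h)))\<^sup>2
      \<le> lam * ((norm (\<Sum>n<N. smul (a n) (\<phi> n g)))\<^sup>2 + (norm (\<Sum>n<N. smul (a n) (\<phi> n h)))\<^sup>2)" for N a
  \<comment> \<open>The sums in \<open>close\<close> run over \<open>0..l\<close> and are never
    empty, so \<open>N = 0\<close> is separate and trivial.\<close>
  proof (cases N)
    case (Suc l)
    define U V where "U = (norm (\<Sum>n<N. smul (a n) (\<phi> n g)))\<^sup>2"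
      and "V = (norm (\<Sum>n<N. smul (a n) (\<phi> n h)))\<^sup>2"
    have I: "{0..l} = {..<N}" using Suc by auto
    have "norm (\<Sum>n<N. smul (a n) (\<phi> n g - \<phi> n h)) \<le> sqrt (lam1 * U + lam2 * V)"
      using close[where l = l and a = a] lam unfolding I U_def V_def
      by (simp add: powr_half_sqrt)
    then have "(norm (\<Sum>n<N. smul (a n) (\<phi> n g - \<phi> n h)))\<^sup>2 \<le> (sqrt (lam1 * U + lam2 * V))\<^sup>2"
      by (rule power_mono) simp
    also have "\<dots> = lam1 * U + lam2 * V" using lam by (simp add: U_def V_def)
    also have "\<dots> \<le> lam * U + lam * V"
      by (intro add_mono mult_right_mono) (simp_all add: lam_def U_def V_def)
    finally show ?thesis by (simp add: U_def V_def distrib_left)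
  qed simp
  then show ?thesis
    unfolding stably_recoverable_def samples
    using recovery_perturbation[OF l2 R, of lam] lam by (simp add: lam_def)
qed

end
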